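(* If $G$ is a graph with an edge dominating circuit, then $$\gamma_{e,g}(G)\le \left\lceil \frac{m(G)}{2}\right\rceil ,$$ and, if $G$ is not a cycle of length $n$ with $n \equiv 1 \pmod 4$, then $$\gamma_{e,g}(G)\le \left\lfloor \frac{m(G)}{2}\right\rfloor$$ also holds under the given conditions (that is, for $G$ with an edge dominating circuit).
   Context: All graphs are finite, simple and undirected; $m(G)$ is the number of edges of $G$. A circuit is a closed trail, i.e. a closed walk $v_0 v_1\dots v_\ell v_0$ with no repeated edge (vertices may repeat). For an edge $e\in E(G)$, its closed neighborhood is $N_G[e]=\{f\in E(G): e\cap f\neq\emptyset\}$ (so $e\in N_G[e]$); $e$ dominates exactly the edges of $N_G[e]$. An edge dominating circuit of $G$ is a circuit $v_0 v_1\dots v_\ell v_0$ such that every $e\in E(G)$ is dominated by an edge $v_iv_{i+1}$ of the circuit, that is, $e\cap\{v_0,\dots,v_\ell\}\neq\emptyset$ for every $e\in E(G)$. A set $D\subseteq E(G)$ is an edge dominating set if $\bigcup_{e\in D}N_G[e]=E(G)$. Edge domination game: two players, Dominator and Staller, take turns choosing an edge of $G$; choosing $e$ is legal if and only if $N_G[e]$ contains at least one edge not dominated by the previously chosen edges. The game finishes when the set of chosen edges is an edge dominating set of $G$. Dominator wants to minimize the total number of chosen edges, Staller wants to maximize it. The game edge domination number $\gamma_{e,g}(G)$ is the total number of edges chosen (by both players) when Dominator moves first and both play optimally.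
   Formalization: The exceptional case is read up to isolated vertices: the second bound is stated when G, after removing its isolated vertices, is not a cycle of length n ≡ 1 (mod 4); as written it fails for C_5 plus an isolated vertex, whose game edge domination number is 3. *)

theory Defs
  imports Complex_Main "HOL-Number_Theory.Cong"
begin

text \<open>A graph is given by its vertex set \<open>V\<close> and its set \<open>E\<close> of edges, which are
  two-element sets of vertices.\<close>

locale fin_simple_graph =
  fixes V :: "'a set" and E :: "'a set set"
  assumes finite_V: "finite V"
    and edge_subset: "e \<in> E \<Longrightarrow> e \<subseteq> V"
    and card_edge: "e \<in> E \<Longrightarrow> card e = 2"

definition closed_nbhd :: "'a set set \<Rightarrow> 'a set \<Rightarrow> 'a set set" where
  "closed_nbhd E e = {f \<in> E. e \<inter> f \<noteq> {}}"

definition dominated :: "'a set set \<Rightarrow> 'a set set \<Rightarrow> 'a set set" where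
  "dominated E D = (\<Union>e\<in>D. closed_nbhd E e)"

definition edge_dominating_set :: "'a set set \<Rightarrow> 'a set set \<Rightarrow> bool" where
  "edge_dominating_set E D \<longleftrightarrow> D \<subseteq> E \<and> dominated E D = E"

text \<open>The list \<open>[v\<^sub>0, \<dots>, v\<^sub>l]\<close> stands for the closed walk \<open>v\<^sub>0 \<dots> v\<^sub>l v\<^sub>0\<close>; the
  step from \<open>v\<^sub>l\<close> back to \<open>v\<^sub>0\<close> is always included, so that a list of length \<open>1\<close>
  contributes the singleton \<open>{v\<^sub>0}\<close>, which is not an edge of a simple graph.\<close>

definition closed_walk_edges :: "'a list \<Rightarrow> 'a set list" where
  "closed_walk_edges vs = map (\<lambda>i. {vs ! i, vs ! (Suc i mod length vs)}) [0..<length vs]"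

definition circuit :: "'a set set \<Rightarrow> 'a list \<Rightarrow> bool" where
  "circuit E vs \<longleftrightarrow> vs \<noteq> [] \<and> set (closed_walk_edges vs) \<subseteq> E \<and> distinct (closed_walk_edges vs)"

definition edge_dominating_circuit :: "'a set set \<Rightarrow> 'a list \<Rightarrow> bool" where
  "edge_dominating_circuit E vs \<longleftrightarrow> circuit E vs \<and> (\<forall>e\<in>E. e \<inter> set vs \<noteq> {})"

definition cycle_graph :: "'a set \<Rightarrow> 'a set set \<Rightarrow> nat \<Rightarrow> bool" where
  "cycle_graph V E n \<longleftrightarrow> n \<ge> 3 \<and>
     (\<exists>vs. length vs = n \<and> distinct vs \<and> V = set vs \<and> E = set (closed_walk_edges vs))"

text \<open>Isolated vertices affect neither the game nor the existence of an edge dominating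
  circuit: the disjoint union of \<open>C\<^sub>5\<close> and \<open>K\<^sub>1\<close> has game edge domination number \<open>3\<close>, just as
  \<open>C\<^sub>5\<close> itself. Whether a graph is an exceptional cycle is therefore to be asked of
  its non-isolated part.\<close>

definition non_isolated :: "'a set \<Rightarrow> 'a set set \<Rightarrow> 'a set" where
  "non_isolated V E = {v \<in> V. \<exists>e\<in>E. v \<in> e}"

text \<open>The edges that may be chosen once the edges in \<open>D\<close> have been chosen.\<close>

definition legal_moves :: "'a set set \<Rightarrow> 'a set set \<Rightarrow> 'a set set" where
  "legal_moves E D = {e \<in> E. closed_nbhd E e - dominated E D \<noteq> {}}"

datatype player = Dominator | Staller

fun opponent :: "player \<Rightarrow> player" where
  "opponent Dominator = Staller"
| "opponent Staller = Dominator"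

fun best :: "player \<Rightarrow> nat set \<Rightarrow> nat" where
  "best Dominator = Min"
| "best Staller = Max"

text \<open>\<open>remaining_moves E p D\<close> is the number of edges still to be chosen under optimal play
  when \<open>D\<close> is the set of edges chosen so far and \<open>p\<close> is to move. The set of edges chosen is
  enough to describe a position, because an edge already chosen is never legal again.
  Finiteness of \<open>E\<close> only serves to make the recursion total.\<close>

function remaining_moves :: "'a set set \<Rightarrow> player \<Rightarrow> 'a set set \<Rightarrow> nat" where
  "remaining_moves E p D =
     (if infinite E \<or> \<not> D \<subseteq> E \<or> edge_dominating_set E D then 0
      else 1 + best p ((\<lambda>e. remaining_moves E (opponent p) (insert e D)) ` legal_moves E D))"
  by pat_completeness auto
termination
proof (relation "measure (\<lambda>(E, p, D). card (E - dominated E D))")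
  fix E :: "'a set set" and p D e
  assume *: "\<not> (infinite E \<or> \<not> D \<subseteq> E \<or> edge_dominating_set E D)" and e: "e \<in> legal_moves E D"
  from e obtain f where "f \<in> closed_nbhd E e" "f \<notin> dominated E D"
    by (auto simp: legal_moves_def)
  then have "E - dominated E (insert e D) \<subset> E - dominated E D"
    by (auto simp: dominated_def closed_nbhd_def)
  with * show "((E, opponent p, insert e D), (E, p, D))
      \<in> measure (\<lambda>(E, p, D). card (E - dominated E D))"
    by (simp add: psubset_card_mono)
qed simp

declare remaining_moves.simps [simp del]

lemma (in fin_simple_graph) legal_moves_nonempty:
  assumes "D \<subseteq> E" "\<not> edge_dominating_set E D"
  shows "legal_moves E D \<noteq> {}"
proof -
  have "dominated E D \<subseteq> E"
    by (auto simp: dominated_def closed_nbhd_def)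
  with assms obtain f where f: "f \<in> E" "f \<notin> dominated E D"
    by (auto simp: edge_dominating_set_def)
  then have "f \<in> closed_nbhd E f"
    using card_edge[of f] by (auto simp: closed_nbhd_def)
  with f show ?thesis by (auto simp: legal_moves_def)
qed

definition game_edge_domination_number :: "'a set set \<Rightarrow> nat" where
  "game_edge_domination_number E = remaining_moves E Dominator {}"

end

theory Submission imports Defs begin

text \<open>Let \<open>F\<close> be the set of undominated edges and weigh it by \<open>|F|\<close> plus the number of components
  of \<open>F\<close> that contain an edge. Every move lowers the weight by at least \<open>1\<close>, and unless \<open>F\<close> is a
  matching, Dominator can lower it by \<open>3\<close>: he plays an edge \<open>{u, v}\<close> such that \<open>u\<close> has a further
  neighbour \<open>z\<close> for which \<open>z\<close> is a leaf or \<open>{u, z}\<close> lies on a cycle. So at most half of the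
  weight many moves remain when Dominator is to move. A graph with an edge dominating circuit
  starts with weight at most \<open>m + 1\<close>, and if \<open>m\<close> is odd it suffices to gain one further unit.
  If some vertex of the circuit has degree at least \<open>3\<close>, a suitable first move lowers the
  weight by \<open>4\<close>; otherwise the graph is a cycle with \<open>m \<equiv> 3 (mod 4)\<close>, on which Dominator can keep
  the undominated edges a path of \<open>4k\<close> edges as long as Staller does not give up a unit herself.\<close>

section \<open>Connectivity, components and weight of an edge set\<close>

definition adj :: "'a set set \<Rightarrow> 'a rel" where
  "adj F = {(a, b). {a, b} \<in> F}"

definition conn :: "'a set set \<Rightarrow> 'a rel" where
  "conn F = (adj F)\<^sup>*"

definition spans :: "'a set set \<Rightarrow> 'a set \<Rightarrow> bool" where
  "spans F R \<longleftrightarrow> (\<forall>x\<in>\<Union>F. \<exists>r\<in>R. (r, x) \<in> conn F)"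

text \<open>The number of connected components that contain an edge, as the least size of a set of
  vertices from which all edges can be reached.\<close>

definition ncomp :: "'a set set \<Rightarrow> nat" where
  "ncomp F = (LEAST k. \<exists>R. finite R \<and> card R = k \<and> spans F R)"

definition weight :: "'a set set \<Rightarrow> nat" where
  "weight F = card F + ncomp F"

text \<open>The conditions on \<open>E\<close> apart from the vertex set; they pass to subsets and
  so hold for the undominated edges of every position.\<close>

definition edge_set :: "'a set set \<Rightarrow> bool" where
  "edge_set F \<longleftrightarrow> finite F \<and> (\<forall>e\<in>F. card e = 2)"

text \<open>What the move \<open>e\<close> leaves of the undominated edges \<open>F\<close>. The
  edge played may itself be dominated already, so \<open>e\<close> need not lie in
  \<open>F\<close>.\<close>

definition clear :: "'a set set \<Rightarrow> 'a set \<Rightarrow> 'a set set" where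
  "clear F e = {f \<in> F. e \<inter> f = {}}"

lemma edge_set_subset: "edge_set F \<Longrightarrow> F' \<subseteq> F \<Longrightarrow> edge_set F'"
  by (auto simp: edge_set_def finite_subset)

lemma edge_set_clear: "edge_set F \<Longrightarrow> edge_set (clear F e)"
  by (rule edge_set_subset) (auto simp: clear_def)

lemma edge_set_edge:
  assumes "edge_set F" "e \<in> F" "a \<in> e"
  obtains b where "e = {a, b}" "a \<noteq> b"
proof -
  have "card e = 2" using assms by (auto simp: edge_set_def)
  then obtain x y where "e = {x, y}" "x \<noteq> y" by (auto simp: card_2_iff)
  with \<open>a \<in> e\<close> show ?thesis using that[of x] that[of y] by auto
qed

lemma edge_set_edge_neq: "edge_set F \<Longrightarrow> {a, b} \<in> F \<Longrightarrow> a \<noteq> b"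
  by (auto simp: edge_set_def)

lemma finite_Union_edge_set: "edge_set F \<Longrightarrow> finite (\<Union>F)"
  unfolding edge_set_def by (metis card.infinite finite_Union zero_neq_numeral)

lemma conn_refl [simp]: "(x, x) \<in> conn F"
  by (simp add: conn_def)

lemma conn_sym: "(x, y) \<in> conn F \<Longrightarrow> (y, x) \<in> conn F"
proof -
  have "sym (adj F)" by (auto simp: sym_def adj_def insert_commute)
  then show "(x, y) \<in> conn F \<Longrightarrow> (y, x) \<in> conn F"
    unfolding conn_def by (meson sym_rtrancl symD)
qed

lemma conn_trans: "(x, y) \<in> conn F \<Longrightarrow> (y, z) \<in> conn F \<Longrightarrow> (x, z) \<in> conn F"
  by (simp add: conn_def)

lemma conn_step: "(x, y) \<in> conn F \<Longrightarrow> {y, z} \<in> F \<Longrightarrow> (x, z) \<in> conn F"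
  unfolding conn_def by (rule rtrancl_into_rtrancl) (auto simp: adj_def)

lemma conn_edge: "{y, z} \<in> F \<Longrightarrow> (y, z) \<in> conn F"
  by (rule conn_step) auto

lemma conn_mono: "F' \<subseteq> F \<Longrightarrow> (x, y) \<in> conn F' \<Longrightarrow> (x, y) \<in> conn F"
  unfolding conn_def by (rule rtrancl_mono[THEN subsetD]) (auto simp: adj_def)

lemma conn_isolated: "(x, y) \<in> conn F \<Longrightarrow> x \<notin> \<Union>F \<Longrightarrow> y = x"
  unfolding conn_def by (induction rule: rtrancl_induct) (auto simp: adj_def)

text \<open>A walk can be shortened until it crosses the deleted edge at most once, in one of its
  two directions.\<close>

lemma conn_delete:
  assumes "(x, y) \<in> conn F"
  shows "(x, y) \<in> conn (F - {{a, b}})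
    \<or> (x, a) \<in> conn (F - {{a, b}}) \<and> (b, y) \<in> conn (F - {{a, b}})
    \<or> (x, b) \<in> conn (F - {{a, b}}) \<and> (a, y) \<in> conn (F - {{a, b}})"
  using assms[unfolded conn_def]
proof (induction rule: rtrancl_induct)
  case base
  show ?case by simp
next
  case (step y z)
  show ?case
  proof (cases "{y, z} = {a, b}")
    case True
    then have "y = a \<and> z = b \<or> y = b \<and> z = a" by (auto simp: doubleton_eq_iff)
    with step.IH show ?thesis by auto
  next
    case False
    with step.hyps have "{y, z} \<in> F - {{a, b}}" by (auto simp: adj_def)
    with step.IH show ?thesis by (meson conn_step)
  qed
qed

section \<open>Component counts and loss of weight under edge deletion\<close>

lemma ncomp_le: "finite R \<Longrightarrow> spans F R \<Longrightarrow> ncomp F \<le> card R"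
  unfolding ncomp_def by (rule Least_le) blast

text \<open>All endpoints together span, so the minimum in \<open>ncomp\<close> is attained.\<close>

lemma ncomp_witness:
  assumes "edge_set F"
  obtains R where "finite R" "card R = ncomp F" "spans F R"
proof -
  have "\<exists>R. finite R \<and> card R = card (\<Union>F) \<and> spans F R"
    using finite_Union_edge_set[OF assms] unfolding spans_def by (intro exI[of _ "\<Union>F"]) (blast intro: conn_refl)
  then have "\<exists>R. finite R \<and> card R = ncomp F \<and> spans F R"
    unfolding ncomp_def by (rule LeastI)
  then show ?thesis using that by blast
qed

text \<open>A representative that reached \<open>a\<close> in \<open>F\<close> still reaches
  \<open>a\<close> or \<open>b\<close>. The other end, taken as an extra representative, restores
  whatever was cut off.\<close>

lemma ncomp_delete:
  assumes F: "edge_set F" and e: "{a, b} \<in> F"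
  shows "ncomp (F - {{a, b}}) \<le> ncomp F + 1"
proof -
  let ?F = "F - {{a, b}}"
  obtain R where R: "finite R" "card R = ncomp F" "spans F R"
    using ncomp_witness[OF F] .
  have "a \<in> \<Union>F" using e by blast
  then obtain s where s: "s \<in> R" "(s, a) \<in> conn F" using R by (auto simp: spans_def)
  have "(s, a) \<in> conn ?F \<or> (s, b) \<in> conn ?F" using conn_delete[OF s(2)] by blast
  then obtain c where c: "spans ?F (insert c R)"
  proof
    assume sa: "(s, a) \<in> conn ?F"
    have "spans ?F (insert b R)"
      unfolding spans_def
    proof
      fix x assume "x \<in> \<Union>?F"
      then obtain r where r: "r \<in> R" "(r, x) \<in> conn F" using R by (fastforce simp: spans_def)
      show "\<exists>r\<in>insert b R. (r, x) \<in> conn ?F"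
        using conn_delete[OF r(2), of a b] r(1) s(1) sa by (meson conn_trans insertCI)
    qed
    then show ?thesis using that by blast
  next
    assume sb: "(s, b) \<in> conn ?F"
    have "spans ?F (insert a R)"
      unfolding spans_def
    proof
      fix x assume "x \<in> \<Union>?F"
      then obtain r where r: "r \<in> R" "(r, x) \<in> conn F" using R by (fastforce simp: spans_def)
      show "\<exists>r\<in>insert a R. (r, x) \<in> conn ?F"
        using conn_delete[OF r(2), of a b] r(1) s(1) sb by (meson conn_trans insertCI)
    qed
    then show ?thesis using that by blast
  qed
  have "ncomp ?F \<le> card (insert c R)" using c R by (intro ncomp_le) auto
  also have "\<dots> \<le> ncomp F + 1" using R by (metis Suc_eq_plus1 card_insert_le_m1 card_insert_if le_refl le_SucI)
  finally show ?thesis .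
qed

lemma card_delete: "edge_set F \<Longrightarrow> e \<in> F \<Longrightarrow> Suc (card (F - {e})) = card F"
  unfolding edge_set_def by (blast intro: card_Suc_Diff1)

text \<open>Remove the edges of \<open>F - F'\<close> one at a time: each deletion takes 1 off
  \<open>card\<close> and adds at most 1 to \<open>ncomp\<close>.\<close>

lemma weight_mono:
  assumes "edge_set F" "F' \<subseteq> F"
  shows "weight F' \<le> weight F"
proof -
  have "finite (F - F')" using assms by (auto simp: edge_set_def)
  moreover have "weight (F - X) \<le> weight F" if "finite X" "X \<subseteq> F" for X
    using that
  proof (induction X rule: finite_induct)
    case empty
    show ?case by simp
  next
    case (insert e X)
    have G: "edge_set (F - X)" using assms(1) by (rule edge_set_subset) auto
    have e: "e \<in> F - X" using insert by auto
    then obtain a b where ab: "e = {a, b}"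
      using assms(1) by (auto simp: edge_set_def card_2_iff)
    have "weight (F - X - {e}) \<le> weight (F - X)"
      using card_delete[OF G e] ncomp_delete[OF G e[unfolded ab]] unfolding weight_def ab by linarith
    moreover have "F - insert e X = F - X - {e}" by auto
    ultimately show ?case using insert by auto
  qed
  from this[of "F - F'"] show ?thesis
    using assms calculation by (simp add: double_diff)
qed

text \<open>The edge lies on a cycle, so the old representatives still span.\<close>

lemma weight_delete_conn:
  assumes F: "edge_set F" and e: "{a, b} \<in> F" and ab: "(a, b) \<in> conn (F - {{a, b}})"
  shows "weight (F - {{a, b}}) + 1 \<le> weight F"
proof -
  let ?F = "F - {{a, b}}"
  obtain R where R: "finite R" "card R = ncomp F" "spans F R"
    using ncomp_witness[OF F] .
  have ba: "(b, a) \<in> conn ?F" using ab by (rule conn_sym)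
  have "spans ?F R" unfolding spans_def
  proof
    fix x assume "x \<in> \<Union>?F"
    then obtain r where r: "r \<in> R" "(r, x) \<in> conn F" using R by (fastforce simp: spans_def)
    show "\<exists>r\<in>R. (r, x) \<in> conn ?F"
      using conn_delete[OF r(2), of a b] r(1) ab ba by (meson conn_trans)
  qed
  then have "ncomp ?F \<le> ncomp F" using ncomp_le R by metis
  with card_delete[OF F e] show ?thesis by (simp add: weight_def)
qed

text \<open>Here \<open>a\<close> is a leaf. A representative placed at \<open>a\<close> moves to
  \<open>b\<close>; the others keep everything they reach except \<open>a\<close>.\<close>

lemma weight_delete_pendant:
  assumes F: "edge_set F" and e: "{a, b} \<in> F" and a: "\<And>f. f \<in> F \<Longrightarrow> a \<in> f \<Longrightarrow> f = {a, b}"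
  shows "weight (F - {{a, b}}) + 1 \<le> weight F"
proof -
  let ?F = "F - {{a, b}}"
  let ?h = "\<lambda>r. if r = a then b else r"
  obtain R where R: "finite R" "card R = ncomp F" "spans F R"
    using ncomp_witness[OF F] .
  have a': "a \<notin> \<Union>?F" using a by auto
  have "spans ?F (?h ` R)" unfolding spans_def
  proof
    fix x assume x: "x \<in> \<Union>?F"
    then obtain r where r: "r \<in> R" "(r, x) \<in> conn F" using R by (fastforce simp: spans_def)
    have "x \<noteq> a" using x a' by auto
    then have ax: "(a, x) \<notin> conn ?F" using conn_isolated[OF _ a'] by blast
    have "(?h r, x) \<in> conn ?F"
      using conn_delete[OF r(2), of a b] ax conn_isolated[OF conn_sym a'] by auto
    with r(1) show "\<exists>r\<in>?h ` R. (r, x) \<in> conn ?F" by blast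
  qed
  then have "ncomp ?F \<le> card (?h ` R)" using R by (intro ncomp_le) auto
  also have "\<dots> \<le> ncomp F" using R card_image_le by metis
  finally show ?thesis using card_delete[OF F e] by (simp add: weight_def)
qed

lemma weight_delete_isolated:
  assumes F: "edge_set F" and e: "e \<in> F" and iso: "\<And>f. f \<in> F \<Longrightarrow> e \<inter> f \<noteq> {} \<Longrightarrow> f = e"
  shows "weight (F - {e}) + 2 \<le> weight F"
proof -
  obtain a b where ab: "e = {a, b}" using F e by (auto simp: edge_set_def card_2_iff)
  let ?F = "F - {{a, b}}"
  obtain R where R: "finite R" "card R = ncomp F" "spans F R"
    using ncomp_witness[OF F] .
  have a': "a \<notin> \<Union>?F" and b': "b \<notin> \<Union>?F" using iso unfolding ab by auto
  note isol = conn_isolated[OF _ a'] conn_isolated[OF _ b']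
    conn_isolated[OF conn_sym a'] conn_isolated[OF conn_sym b']
  have "spans ?F (R - {a, b})" unfolding spans_def
  proof
    fix x assume x: "x \<in> \<Union>?F"
    then obtain r where r: "r \<in> R" "(r, x) \<in> conn F" using R by (fastforce simp: spans_def)
    have "x \<noteq> a" "x \<noteq> b" using x a' b' by auto
    then have "(a, x) \<notin> conn ?F" "(b, x) \<notin> conn ?F" using isol by blast+
    then have "(r, x) \<in> conn ?F \<and> r \<notin> {a, b}"
      using conn_delete[OF r(2), of a b] by auto
    with r(1) show "\<exists>r\<in>R - {a, b}. (r, x) \<in> conn ?F" by blast
  qed
  then have 1: "ncomp ?F \<le> card (R - {a, b})" using R by (intro ncomp_le) auto
  have "a \<in> \<Union>F" using e ab by blast
  then obtain r where r: "r \<in> R" "(r, a) \<in> conn F" using R by (auto simp: spans_def)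
  have "r \<in> {a, b}" using conn_delete[OF r(2), of a b] isol by blast
  then have "card (R - {a, b}) < card R" using r(1) R(1) by (intro psubset_card_mono) auto
  with 1 show ?thesis using card_delete[OF F e] R(2) unfolding weight_def ab by linarith
qed

section \<open>Gain of a single move\<close>

lemma weight_clear:
  assumes F: "edge_set F" and ne: "clear F e \<noteq> F"
  shows "weight (clear F e) + 1 \<le> weight F"
proof -
  obtain f a where f: "f \<in> F" "a \<in> e" "a \<in> f" using ne by (auto simp: clear_def)
  obtain b where b: "f = {a, b}" using edge_set_edge[OF F f(1) f(3)] .
  \<comment> \<open>Keeping only \<open>f\<close> among the edges at \<open>a\<close> turns
    \<open>a\<close> into a leaf, so that deleting \<open>f\<close> gains 1.\<close>
  let ?G = "insert f {g \<in> F. a \<notin> g}"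
  have sub: "?G \<subseteq> F" using f by auto
  then have G: "edge_set ?G" using F edge_set_subset by blast
  have "clear F e \<subseteq> ?G - {{a, b}}" using f b by (auto simp: clear_def)
  then have "weight (clear F e) \<le> weight (?G - {{a, b}})"
    using G by (meson weight_mono edge_set_subset Diff_subset)
  also have "weight (?G - {{a, b}}) + 1 \<le> weight ?G"
    using G b by (intro weight_delete_pendant) auto
  also have "weight ?G \<le> weight F" using F sub by (rule weight_mono)
  finally show ?thesis by simp
qed

text \<open>Once all other edges that meet \<open>e\<close> are gone, \<open>e\<close> is a component of its own. An edge
  that can be discarded with gain before this happens adds its gain to the final \<open>2\<close>.\<close>

lemma weight_clear_edge:
  assumes F: "edge_set F" and G: "G \<subseteq> F" and e: "e \<in> G" and sub: "clear F e \<subseteq> G"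
  shows "weight (clear F e) + 2 \<le> weight G"
proof -
  let ?H = "insert e (clear F e)"
  have H: "edge_set ?H" using F G e by (intro edge_set_subset[OF F]) (auto simp: clear_def)
  have "e \<noteq> {}" using F G e unfolding edge_set_def by (metis card.empty subsetD zero_neq_numeral)
  then have "weight (?H - {e}) + 2 \<le> weight ?H"
    using H by (intro weight_delete_isolated) (auto simp: clear_def)
  moreover have "?H - {e} = clear F e" using \<open>e \<noteq> {}\<close> by (auto simp: clear_def)
  moreover have "weight ?H \<le> weight G"
    using edge_set_subset[OF F G] e sub by (intro weight_mono) auto
  ultimately show ?thesis by simp
qed

text \<open>Take an edge \<open>{u, z}\<close>, with \<open>u\<close> of degree at least \<open>2\<close>, for which the component of \<open>z\<close>
  after deletion of the edge is as small as possible. If it is a bridge, then \<open>z\<close> is a leaf.\<close>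

lemma leaf_or_non_bridge:
  assumes F: "edge_set F" and "{u, z} \<in> F" "{u, v} \<in> F" "v \<noteq> z"
  shows "\<exists>u z v. {u, z} \<in> F \<and> {u, v} \<in> F \<and> v \<noteq> z \<and>
    ((\<forall>f\<in>F. z \<in> f \<longrightarrow> f = {u, z}) \<or> (u, z) \<in> conn (F - {{u, z}}))"
  using assms(2-)
proof (induction "card (conn (F - {{u, z}}) `` {z})" arbitrary: u z v rule: less_induct)
  case less
  show ?case
  proof (cases "\<forall>f\<in>F. z \<in> f \<longrightarrow> f = {u, z}")
    case True
    with less.prems show ?thesis by blast
  next
    case False
    then obtain f where f: "f \<in> F" "z \<in> f" "f \<noteq> {u, z}" by blast
    obtain y where y: "f = {z, y}" "z \<noteq> y" using edge_set_edge[OF F f(1,2)] .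
    have yu: "y \<noteq> u" using f y by auto
    \<comment> \<open>The edge \<open>{z, y}\<close> takes over the role of \<open>{u, z}\<close>,
      with \<open>u\<close> as the further neighbour of \<open>z\<close>.\<close>
    have zu: "{z, u} \<in> F" using less.prems by (simp add: insert_commute)
    show ?thesis
    proof (cases "(z, y) \<in> conn (F - {{z, y}})")
      case True
      with f y zu yu show ?thesis by blast
    next
      case False
      have far: "(y, z) \<notin> conn (F - {{z, y}})" using False conn_sym[of y z] by blast
      have uz: "{u, z} \<in> F - {{z, y}}" using less.prems(1) yu f(3) y(1) by auto
      have "(y, u) \<notin> conn (F - {{z, y}})" using far conn_step[OF _ uz] by blast
      then have far': "(y, u) \<notin> conn (F - {{z, y}} - {{u, z}})" "(y, z) \<notin> conn (F - {{z, y}} - {{u, z}})"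
        using far conn_mono[of "F - {{z, y}} - {{u, z}}" "F - {{z, y}}"] by blast+
      have zy: "(z, y) \<in> conn (F - {{u, z}})" using f y by (intro conn_edge) auto
      \<comment> \<open>Beyond the bridge \<open>{z, y}\<close> neither \<open>u\<close> nor
        \<open>z\<close> is reachable from \<open>y\<close>. So this component survives the deletion
        of \<open>{u, z}\<close>, where it hangs at \<open>z\<close>, and it lacks \<open>z\<close>
        itself.\<close>
      have "conn (F - {{z, y}}) `` {y} \<subseteq> conn (F - {{u, z}}) `` {z}"
      proof
        fix x assume "x \<in> conn (F - {{z, y}}) `` {y}"
        then have "(y, x) \<in> conn (F - {{z, y}} - {{u, z}})"
          using conn_delete[of y x "F - {{z, y}}" u z] far' by auto
        then have "(y, x) \<in> conn (F - {{u, z}})" by (rule conn_mono[rotated]) auto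
        with zy show "x \<in> conn (F - {{u, z}}) `` {z}" using conn_trans by fast
      qed
      moreover have "z \<in> conn (F - {{u, z}}) `` {z}" "z \<notin> conn (F - {{z, y}}) `` {y}"
        using far by auto
      ultimately have "conn (F - {{z, y}}) `` {y} \<subset> conn (F - {{u, z}}) `` {z}" by blast
      moreover have "finite (conn (F - {{u, z}}) `` {z})"
      proof (rule finite_subset)
        show "conn (F - {{u, z}}) `` {z} \<subseteq> insert z (\<Union>F)"
        proof
          fix x assume "x \<in> conn (F - {{u, z}}) `` {z}"
          then have "(x, z) \<in> conn (F - {{u, z}})" using conn_sym[of z x] by blast
          then have "x \<in> \<Union>(F - {{u, z}}) \<or> x = z" using conn_isolated by metis
          then show "x \<in> insert z (\<Union>F)" by blast
        qed
      qed (use finite_Union_edge_set[OF F] in auto)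
      ultimately have "card (conn (F - {{z, y}}) `` {y}) < card (conn (F - {{u, z}}) `` {z})"
        by (rule psubset_card_mono[rotated])
      from less.hyps[OF this _ zu] f y yu show ?thesis by blast
    qed
  qed
qed

text \<open>The move \<open>{u, v}\<close> also clears \<open>{u, z}\<close>, because both contain
  \<open>u\<close>. Deleting \<open>{u, z}\<close> first gains 1, and the move itself then gains
  2.\<close>

lemma dominator_gain:
  assumes F: "edge_set F" and ef: "e \<in> F" "f \<in> F" "e \<noteq> f" "e \<inter> f \<noteq> {}"
  shows "\<exists>e\<in>F. weight (clear F e) + 3 \<le> weight F"
proof -
  obtain x where x: "x \<in> e" "x \<in> f" using ef by blast
  obtain y where y: "e = {x, y}" using edge_set_edge[OF F ef(1) x(1)] .
  obtain y' where y': "f = {x, y'}" using edge_set_edge[OF F ef(2) x(2)] .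
  have "y' \<noteq> y" using ef y y' by auto
  then obtain u z v where uz: "{u, z} \<in> F" and uv: "{u, v} \<in> F" and "v \<noteq> z"
    and or: "(\<forall>f\<in>F. z \<in> f \<longrightarrow> f = {u, z}) \<or> (u, z) \<in> conn (F - {{u, z}})"
    using leaf_or_non_bridge[OF F, of x y y'] ef y y' by auto
  from or have "weight (F - {{u, z}}) + 1 \<le> weight F"
  proof
    assume leaf: "\<forall>f\<in>F. z \<in> f \<longrightarrow> f = {u, z}"
    have "weight (F - {{z, u}}) + 1 \<le> weight F"
    proof (rule weight_delete_pendant[OF F])
      show "{z, u} \<in> F" using uz by (metis insert_commute)
      show "f = {z, u}" if "f \<in> F" "z \<in> f" for f using leaf that by (metis insert_commute)
    qed
    then show ?thesis by (metis insert_commute)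
  qed (rule weight_delete_conn[OF F uz])
  moreover have "weight (clear F {u, v}) + 2 \<le> weight (F - {{u, z}})"
    using uv \<open>v \<noteq> z\<close> by (intro weight_clear_edge[OF F]) (auto simp: clear_def doubleton_eq_iff)
  ultimately show ?thesis using uv by force
qed

text \<open>Each edge of a matching is a component and weighs 2. This serves the positions to which
  \<open>dominator_gain\<close> does not apply.\<close>

lemma weight_matching:
  assumes "edge_set F" "\<And>e f. e \<in> F \<Longrightarrow> f \<in> F \<Longrightarrow> e \<inter> f \<noteq> {} \<Longrightarrow> e = f"
  shows "2 * card F \<le> weight F"
proof -
  have "finite F" using assms by (simp add: edge_set_def)
  then show ?thesis using assms
  proof (induction F rule: finite_induct)
    case empty
    show ?case by simp
  next
    case (insert e F)
    have "weight (insert e F - {e}) + 2 \<le> weight (insert e F)"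
      using insert.prems by (intro weight_delete_isolated) auto
    moreover have "2 * card F \<le> weight F"
      using insert.prems edge_set_subset[of "insert e F" F] by (intro insert.IH) auto
    ultimately show ?case using insert.hyps by simp
  qed
qed

section \<open>Undominated edges and bounds for the value of the game\<close>

definition live :: "'a set set \<Rightarrow> 'a set set \<Rightarrow> 'a set set" where
  "live E D = E - dominated E D"

lemma live_empty [simp]: "live E {} = E"
  by (simp add: live_def dominated_def)

text \<open>Lets each position be studied through its undominated edges alone.\<close>

lemma live_insert: "live E (insert e D) = clear (live E D) e"
  by (auto simp: live_def dominated_def closed_nbhd_def clear_def)

lemma edge_set_live: "edge_set E \<Longrightarrow> edge_set (live E D)"
  by (rule edge_set_subset) (auto simp: live_def)

lemma legal_moves_iff: "e \<in> legal_moves E D \<longleftrightarrow> e \<in> E \<and> clear (live E D) e \<noteq> live E D"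
  by (auto simp: legal_moves_def live_def closed_nbhd_def clear_def)

lemma edge_dominating_set_iff: "D \<subseteq> E \<Longrightarrow> edge_dominating_set E D \<longleftrightarrow> live E D = {}"
  by (auto simp: edge_dominating_set_def live_def dominated_def closed_nbhd_def)

lemma remaining_moves_over: "live E D = {} \<Longrightarrow> remaining_moves E p D = 0"
  by (subst remaining_moves.simps) (simp add: edge_dominating_set_iff)

lemma remaining_moves_Dominator_le:
  assumes "edge_set E" "D \<subseteq> E" "e \<in> E" "clear (live E D) e \<noteq> live E D"
    and "remaining_moves E Staller (insert e D) \<le> k"
  shows "remaining_moves E Dominator D \<le> Suc k"
proof -
  have fin: "finite E" using assms by (simp add: edge_set_def)
  have e: "e \<in> legal_moves E D" using assms by (simp add: legal_moves_iff)
  have "finite (legal_moves E D)" using fin by (simp add: legal_moves_def)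
  then have "Min ((\<lambda>e. remaining_moves E Staller (insert e D)) ` legal_moves E D) \<le> k"
    using e assms(5) by (meson Min_le finite_imageI imageI order_trans)
  then show ?thesis by (subst remaining_moves.simps) auto
qed

lemma clear_self: "edge_set F \<Longrightarrow> f \<in> F \<Longrightarrow> clear F f \<noteq> F"
proof
  assume "edge_set F" "f \<in> F" "clear F f = F"
  then have "f \<inter> f = {}" "card f = 2" by (auto simp: clear_def edge_set_def)
  then show False by simp
qed

lemma remaining_moves_Staller_le:
  assumes E: "edge_set E" and "D \<subseteq> E"
    and step: "\<And>e. e \<in> E \<Longrightarrow> clear (live E D) e \<noteq> live E D \<Longrightarrow>
      remaining_moves E Dominator (insert e D) \<le> k"
  shows "remaining_moves E Staller D \<le> Suc k"
proof (cases "live E D = {}")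
  case True
  then show ?thesis by (simp add: remaining_moves_over)
next
  case False
  then obtain f where f: "f \<in> live E D" by blast
  have "f \<in> legal_moves E D"
    using clear_self[OF edge_set_live[OF E] f] f by (simp add: legal_moves_iff live_def)
  then have "legal_moves E D \<noteq> {}" by blast
  moreover have "finite (legal_moves E D)" using E by (simp add: legal_moves_def edge_set_def)
  ultimately have "Max ((\<lambda>e. remaining_moves E Dominator (insert e D)) ` legal_moves E D) \<le> k"
    using step by (subst Max_le_iff) (simp_all add: legal_moves_iff)
  then show ?thesis by (subst remaining_moves.simps) auto
qed

lemma card_clear_less: "edge_set F \<Longrightarrow> clear F e \<noteq> F \<Longrightarrow> card (clear F e) < card F"
  by (rule psubset_card_mono) (auto simp: clear_def edge_set_def)

text \<open>Whoever moves, a legal move dominates a new edge. The bound is good enough when the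
  undominated edges form a matching.\<close>

lemma remaining_moves_le_card:
  assumes E: "edge_set E"
  shows "D \<subseteq> E \<Longrightarrow> remaining_moves E p D \<le> card (live E D)"
proof (induction "card (live E D)" arbitrary: D p rule: less_induct)
  case less
  show ?case
  proof (cases "live E D = {}")
    case True
    then show ?thesis by (simp add: remaining_moves_over)
  next
    case False
    note L = edge_set_live[OF E]
    have bound: "remaining_moves E q (insert e D) \<le> card (live E D) - 1"
      if "e \<in> E" "clear (live E D) e \<noteq> live E D" for e q
      using less.hyps[of "insert e D" q] less.prems that card_clear_less[OF L that(2)]
      by (simp add: live_insert)
    have pos: "card (live E D) > 0" using False L[of D] by (simp add: edge_set_def card_gt_0_iff)
    obtain f where f: "f \<in> live E D" using False by blast
    then have f': "f \<in> E" "clear (live E D) f \<noteq> live E D"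
      using clear_self[OF L f] by (auto simp: live_def)
    have "remaining_moves E p D \<le> Suc (card (live E D) - 1)"
    proof (cases p)
      case Dominator
      then show ?thesis using remaining_moves_Dominator_le[OF E less.prems f'] bound[OF f'] by simp
    next
      case Staller
      then show ?thesis using remaining_moves_Staller_le[OF E less.prems] bound by simp
    qed
    with pos show ?thesis by simp
  qed
qed

text \<open>Unless a matching is left, Dominator can take off 3, and Staller takes off at least 1,
  so two moves cost 4 units. With Staller to move the bound is rounded up, since her move may cost
  only 1.\<close>

lemma remaining_moves_le_weight:
  assumes E: "edge_set E"
  shows "D \<subseteq> E \<Longrightarrow> remaining_moves E Dominator D \<le> weight (live E D) div 2
    \<and> remaining_moves E Staller D \<le> (weight (live E D) + 1) div 2"
proof (induction "card (live E D)" arbitrary: D rule: less_induct)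
  case less
  let ?L = "live E D"
  have L: "edge_set ?L" using E by (rule edge_set_live)
  have IH: "remaining_moves E Dominator (insert e D) \<le> weight (clear ?L e) div 2 \<and>
      remaining_moves E Staller (insert e D) \<le> (weight (clear ?L e) + 1) div 2"
    if "e \<in> E" "clear ?L e \<noteq> ?L" for e
    using less.hyps[of "insert e D"] less.prems that card_clear_less[OF L that(2)]
    by (simp add: live_insert)
  have "remaining_moves E Dominator D \<le> weight ?L div 2"
  proof (cases "\<forall>e\<in>?L. \<forall>f\<in>?L. e \<inter> f \<noteq> {} \<longrightarrow> e = f")
    case True
    \<comment> \<open>The number of edges of a matching is at most half its weight, and every move
      uses up at least one edge.\<close>
    then have "2 * card ?L \<le> weight ?L" using L by (intro weight_matching) auto
    then show ?thesis using remaining_moves_le_card[OF E less.prems, of Dominator] by simp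
  next
    case False
    then obtain e where e: "e \<in> ?L" and gain: "weight (clear ?L e) + 3 \<le> weight ?L"
      using dominator_gain[OF L] by blast
    then have e': "e \<in> E" "clear ?L e \<noteq> ?L" using clear_self[OF L e] by (auto simp: live_def)
    from IH[OF e'] have "remaining_moves E Dominator D \<le> Suc ((weight (clear ?L e) + 1) div 2)"
      by (intro remaining_moves_Dominator_le[OF E less.prems e']) auto
    with gain show ?thesis by linarith
  qed
  moreover have "remaining_moves E Staller D \<le> (weight ?L + 1) div 2"
  proof (cases "?L = {}")
    case True
    then show ?thesis by (simp add: remaining_moves_over)
  next
    case False
    then have "card ?L > 0" using L by (simp add: edge_set_def card_gt_0_iff)
    then have pos: "weight ?L > 0" by (simp add: weight_def)
    have "remaining_moves E Staller D \<le> Suc ((weight ?L - 1) div 2)"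
    proof (rule remaining_moves_Staller_le[OF E less.prems])
      fix e assume e: "e \<in> E" "clear ?L e \<noteq> ?L"
      have "weight (clear ?L e) \<le> weight ?L - 1" using weight_clear[OF L e(2)] by simp
      then have "weight (clear ?L e) div 2 \<le> (weight ?L - 1) div 2" by (rule div_le_mono)
      with IH[OF e] show "remaining_moves E Dominator (insert e D) \<le> (weight ?L - 1) div 2"
        by simp
    qed
    with pos show ?thesis by linarith
  qed
  ultimately show ?case by blast
qed

section \<open>First move at a circuit vertex with a third edge\<close>

lemma walk_conn:
  assumes "l \<le> m" "\<And>j. l \<le> j \<Longrightarrow> j < m \<Longrightarrow> {p j, p (Suc j)} \<in> F"
  shows "(p l, p m) \<in> conn F"
  using assms
proof (induction rule: dec_induct)
  case (step k)
  then show ?case using conn_step by (metis less_Suc_eq)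
qed simp

text \<open>With \<open>v = p 0\<close>, \<open>u = p (n - 1)\<close> and \<open>z = p (n - 2)\<close>, deleting \<open>{u, z}\<close> turns the circuit
  into an open trail and disconnects nothing. A third edge at \<open>v\<close> can then also be deleted with
  gain, before the edge \<open>{u, v}\<close> is played.\<close>

lemma first_move_gain:
  assumes E: "edge_set E" and n: "n \<ge> 3"
    and edge: "\<And>k. k < n \<Longrightarrow> {p k, p (Suc k)} \<in> E"
    and inj: "inj_on (\<lambda>k. {p k, p (Suc k)}) {..<n}"
    and closed: "p n = p 0"
    and dom: "\<And>e. e \<in> E \<Longrightarrow> \<exists>k<n. p k \<in> e"
    and h: "h \<in> E" "p 0 \<in> h" "h \<noteq> {p 0, p 1}" "h \<noteq> {p (n - 1), p 0}"
  shows "\<exists>e\<in>E. weight (clear E e) + 4 \<le> weight E"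
proof -
  define c where "c k = {p k, p (Suc k)}" for k
  have cE: "c k \<in> E" if "k < n" for k using edge that by (simp add: c_def)
  have c_eq: "c i = c j \<longleftrightarrow> i = j" if "i < n" "j < n" for i j
    using inj that by (auto simp: c_def inj_on_def)
  have nbr: "p k \<noteq> p (Suc k)" if "k < n" for k
    using edge_set_edge_neq[OF E edge[OF that]] .
  have last: "c (n - 1) = {p (n - 1), p 0}" using n closed by (simp add: c_def)
  have prev: "c (n - 2) = {p (n - 2), p (n - 1)}" using n by (simp add: c_def Suc_diff_Suc numeral_2_eq_2)
  let ?F = "E - {c (n - 2)}"
  have F: "edge_set ?F" using E edge_set_subset by blast
  have z: "p (n - 2) \<noteq> p 0"
  proof
    assume "p (n - 2) = p 0"
    then have "c (n - 2) = c (n - 1)" using last prev by auto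
    then show False using c_eq[of "n - 2" "n - 1"] n by simp
  qed
  have wF: "weight ?F + 1 \<le> weight E"
    unfolding prev
  proof (rule weight_delete_conn[OF E])
    show "{p (n - 2), p (n - 1)} \<in> E" using cE[of "n - 2"] n prev by simp
    have "(p 0, p (n - 2)) \<in> conn (E - {c (n - 2)})"
      using c_eq cE by (intro walk_conn) (auto simp flip: c_def)
    moreover have "c (n - 1) \<in> E - {c (n - 2)}" using cE c_eq n by auto
    then have "(p (n - 1), p 0) \<in> conn (E - {c (n - 2)})" unfolding last by (rule conn_edge)
    ultimately have "(p (n - 1), p (n - 2)) \<in> conn (E - {c (n - 2)})" by (rule conn_trans[rotated])
    then show "(p (n - 2), p (n - 1)) \<in> conn (E - {{p (n - 2), p (n - 1)}})"
      unfolding prev by (rule conn_sym)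
  qed
  have "\<exists>g\<in>?F. p 0 \<in> g \<and> g \<noteq> c (n - 1) \<and> weight (?F - {g}) + 1 \<le> weight ?F"
  proof (cases "\<exists>i. 0 < i \<and> i < n \<and> p i = p 0")
    case True
    \<comment> \<open>The circuit returns to \<open>p 0\<close> at step \<open>i\<close>. The edge
      \<open>c (i - 1)\<close> of this return closes the initial segment into a closed trail and
      serves as \<open>g\<close>.\<close>
    then obtain i where i: "0 < i" "i < n" "p i = p 0" by blast
    have "i \<noteq> 1" using nbr[of 0] i n by auto
    moreover have "i \<noteq> n - 1" using nbr[of "n - 1"] i n closed by auto
    moreover have "i \<noteq> n - 2" using z i by auto
    ultimately have i': "2 \<le> i" "i < n - 2" using i by auto
    have ci: "c (i - 1) = {p (i - 1), p 0}" using i by (simp add: c_def)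
    have in_F: "c (i - 1) \<in> ?F" and ne: "c (i - 1) \<noteq> c (n - 1)" using cE c_eq i' by auto
    have "(p 0, p (i - 1)) \<in> conn (?F - {c (i - 1)})"
      using c_eq cE i' by (intro walk_conn) (auto simp flip: c_def)
    then have "weight (?F - {c (i - 1)}) + 1 \<le> weight ?F"
      using weight_delete_conn[OF F, of "p (i - 1)" "p 0"] in_F conn_sym ci by metis
    with in_F ne ci show ?thesis by blast
  next
    case False
    \<comment> \<open>Since \<open>p 0\<close> is visited only once, its only circuit edges are the
      first and the last.\<close>
    have notc: "h \<noteq> c j" if "j < n" for j
    proof
      assume hj: "h = c j"
      then have "p 0 = p j \<or> p 0 = p (Suc j)" using h by (auto simp: c_def)
      then have "j = 0 \<or> Suc j = n"
        using False that by (metis Suc_lessI gr0I zero_less_Suc)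
      then have "c j = {p 0, p 1} \<or> j = n - 1" by (auto simp: c_def)
      then show False using hj h(3,4) last by metis
    qed
    have hF: "h \<in> ?F" using h notc n by auto
    let ?G = "?F - {h}"
    have reach: "(p 0, p k) \<in> conn ?G" if "k < n" for k
    proof (cases "k = n - 1")
      case True
      have "c (n - 1) \<in> ?G" using cE c_eq notc[of "n - 1"] n by auto
      then show ?thesis unfolding True last using conn_edge conn_sym by metis
    next
      case False
      have "c j \<in> ?G" if "j < k" for j
        using cE[of j] c_eq[of j "n - 2"] notc[of j] n that \<open>k < n\<close> False by auto
      then show ?thesis by (intro walk_conn) (auto simp flip: c_def)
    qed
    obtain a where a: "h = {p 0, a}" "p 0 \<noteq> a" using edge_set_edge[OF E h(1,2)] .
    have "weight ?G + 1 \<le> weight ?F"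
    proof (cases "\<forall>f\<in>?F. a \<in> f \<longrightarrow> f = h")
      case True
      have h': "h = {a, p 0}" using a(1) by (simp add: insert_commute)
      show ?thesis
        unfolding h' by (rule weight_delete_pendant[OF F]) (use True hF h' in blast)+
    next
      case False
      \<comment> \<open>The further edge \<open>f\<close> at \<open>a\<close> meets the circuit, all
        of which \<open>p 0\<close> reaches without \<open>h\<close>. So \<open>a\<close> stays
        connected to \<open>p 0\<close>, and \<open>h\<close> is no bridge.\<close>
      then obtain f where f: "f \<in> ?F" "a \<in> f" "f \<noteq> h" by blast
      obtain b where b: "f = {a, b}" using edge_set_edge[OF F f(1,2)] .
      obtain k where k: "k < n" "p k \<in> f" using dom f by blast
      have ba: "{b, a} \<in> ?G" using f b by (auto simp: insert_commute)
      have "(p 0, a) \<in> conn ?G"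
      proof (cases "p k = a")
        case True
        then show ?thesis using reach k by blast
      next
        case False
        then have "p k = b" using k b by auto
        then show ?thesis using reach[OF k(1)] ba conn_step by metis
      qed
      then show ?thesis using weight_delete_conn[OF F, of "p 0" a] hF unfolding a(1) by blast
    qed
    then show ?thesis using hF h last by auto
  qed
  then obtain g where g: "g \<in> ?F" "p 0 \<in> g" "g \<noteq> c (n - 1)"
    and wg: "weight (?F - {g}) + 1 \<le> weight ?F" by blast
  \<comment> \<open>Both discarded edges meet \<open>c (n - 1)\<close>, so this move clears them
    too; the gains add up to 1 + 1 + 2.\<close>
  have "weight (clear E (c (n - 1))) + 2 \<le> weight (?F - {g})"
  proof (rule weight_clear_edge[OF E])
    show "c (n - 1) \<in> ?F - {g}" using cE c_eq g n by auto
    show "clear E (c (n - 1)) \<subseteq> ?F - {g}"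
      using g(2) unfolding clear_def last prev by auto
  qed auto
  with wF wg show ?thesis using cE[of "n - 1"] n by (intro bexI[of _ "c (n - 1)"]) auto
qed

section \<open>Play on paths and cycles\<close>

definition path_edge :: "'a list \<Rightarrow> nat \<Rightarrow> 'a set" where
  "path_edge vs i = {vs ! i, vs ! Suc i}"

text \<open>With the closing edge set apart, the other edges are indexed without a modulus, and
  intervals of indices are paths.\<close>

lemma closed_walk_edges_eq_path:
  assumes "vs \<noteq> []"
  shows "set (closed_walk_edges vs) =
    insert {vs ! (length vs - 1), vs ! 0} (path_edge vs ` {0..<length vs - 1})"
proof -
  obtain m where m: "length vs = Suc m" using assms by (cases vs) auto
  have "set (closed_walk_edges vs) =
      (\<lambda>i. {vs ! i, vs ! (Suc i mod Suc m)}) ` insert m {0..<m}"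
    unfolding closed_walk_edges_def m by (auto simp: less_Suc_eq)
  also have "\<dots> = insert {vs ! m, vs ! 0} (path_edge vs ` {0..<m})"
    by (auto simp: path_edge_def)
  finally show ?thesis by (simp add: m)
qed

lemma path_edge_disjoint_iff:
  "distinct vs \<Longrightarrow> Suc i < length vs \<Longrightarrow> Suc j < length vs \<Longrightarrow>
    path_edge vs i \<inter> path_edge vs j = {} \<longleftrightarrow> Suc i < j \<or> Suc j < i"
  by (auto simp: path_edge_def nth_eq_iff_index_eq)

lemma clear_image: "clear (f ` I) e = f ` {i \<in> I. e \<inter> f i = {}}"
  by (auto simp: clear_def)

lemma clear_path:
  assumes "distinct vs" "b < length vs" "Suc j < length vs"
  shows "clear (path_edge vs ` {a..<b}) (path_edge vs j) =
    path_edge vs ` {i \<in> {a..<b}. Suc i < j \<or> Suc j < i}"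
proof -
  have "path_edge vs j \<inter> path_edge vs i = {} \<longleftrightarrow> Suc j < i \<or> Suc i < j" if "i \<in> {a..<b}" for i
    using path_edge_disjoint_iff[OF assms(1,3)] assms that by auto
  then have "{i \<in> {a..<b}. path_edge vs j \<inter> path_edge vs i = {}} =
      {i \<in> {a..<b}. Suc i < j \<or> Suc j < i}"
    by blast
  then show ?thesis by (simp only: clear_image)
qed

text \<open>The vertex \<open>vs ! a\<close> reaches the whole path, so there is at most one
  component.\<close>

lemma weight_path: "weight (path_edge vs ` {a..<b}) \<le> b - a + 1"
proof -
  let ?F = "path_edge vs ` {a..<b}"
  have reach: "(vs ! a, vs ! i) \<in> conn ?F" if "a \<le> i" "i \<le> b" for i
    using that by (intro walk_conn[where p = "(!) vs"]) (auto simp flip: path_edge_def)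
  have "spans ?F {vs ! a}" unfolding spans_def
  proof
    fix x assume "x \<in> \<Union>?F"
    then obtain i where i: "a \<le> i" "i < b" "x = vs ! i \<or> x = vs ! Suc i"
      by (auto simp: path_edge_def)
    then show "\<exists>r\<in>{vs ! a}. (r, x) \<in> conn ?F" using reach[of i] reach[of "Suc i"] by auto
  qed
  then have "ncomp ?F \<le> 1" using ncomp_le[of "{vs ! a}"] by simp
  moreover have "card ?F \<le> b - a" using card_image_le[of "{a..<b}" "path_edge vs"] by simp
  ultimately show ?thesis by (simp add: weight_def)
qed

text \<open>On a path inside a cycle, Staller either shortens the path by its first or last edge, to
  which Dominator answers with the second edge, or plays an edge of the path and loses one unit
  of weight against the general bound.\<close>

lemma Staller_on_path:
  assumes E: "edge_set E" and vs: "distinct vs" and len: "length vs \<ge> 3"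
    and E_eq: "E = set (closed_walk_edges vs)"
  shows "D \<subseteq> E \<Longrightarrow> live E D = path_edge vs ` {a..<a + 4 * k} \<Longrightarrow> 0 < a \<Longrightarrow>
    Suc (a + 4 * k) < length vs \<Longrightarrow> remaining_moves E Staller D \<le> 2 * k"
proof (induction k arbitrary: a D)
  case 0
  then show ?case by (simp add: remaining_moves_over)
next
  case (Suc k)
  let ?L = "path_edge vs ` {a..<a + 4 * Suc k}"
  have E_path: "E = insert {vs ! (length vs - 1), vs ! 0} (path_edge vs ` {0..<length vs - 1})"
    unfolding E_eq by (rule closed_walk_edges_eq_path) (use len in auto)
  have L: "edge_set ?L" using edge_set_live[OF E, of D] Suc.prems by simp
  have "remaining_moves E Staller D \<le> Suc (2 * k + 1)"
  proof (rule remaining_moves_Staller_le[OF E Suc.prems(1)])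
    fix e assume e: "e \<in> E" and ne: "clear (live E D) e \<noteq> live E D"
    have D': "insert e D \<subseteq> E" using e Suc.prems by simp
    have live': "live E (insert e D) = clear ?L e" using Suc.prems by (simp add: live_insert)
    show "remaining_moves E Dominator (insert e D) \<le> 2 * k + 1"
    proof (cases "e \<in> ?L")
      case True
      \<comment> \<open>A move inside the path costs 2: from at most \<open>4 * k + 5\<close> the
        weight falls to at most \<open>4 * k + 3\<close>.\<close>
      have "weight (clear ?L e) + 2 \<le> weight ?L"
        using True by (intro weight_clear_edge[OF L]) (auto simp: clear_def)
      with weight_path[of vs a "a + 4 * Suc k"] have "weight (clear ?L e) \<le> 4 * k + 3" by simp
      then have "weight (clear ?L e) div 2 \<le> 2 * k + 1" by linarith
      then show ?thesis
        using remaining_moves_le_weight[OF E D'] unfolding live' by linarith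
    next
      case False
      obtain i where i: "a \<le> i" "i < a + 4 * Suc k" "e \<inter> path_edge vs i \<noteq> {}"
        using ne unfolding Suc.prems(2) clear_def by fastforce
      \<comment> \<open>The conditions \<open>0 < a\<close> and
        \<open>Suc (a + 4 * Suc k) < length vs\<close> keep both ends of the closing edge off the
        path.\<close>
      have "e \<noteq> {vs ! (length vs - 1), vs ! 0}"
      proof
        assume "e = {vs ! (length vs - 1), vs ! 0}"
        with i(3) have "vs ! (length vs - 1) = vs ! i \<or> vs ! (length vs - 1) = vs ! Suc i \<or>
            vs ! 0 = vs ! i \<or> vs ! 0 = vs ! Suc i"
          by (auto simp: path_edge_def)
        moreover have "vs ! x \<noteq> vs ! y" if "x \<noteq> y" "x < length vs" "y < length vs" for x y
          using that nth_eq_iff_index_eq[OF vs] by blast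
        moreover have "length vs - 1 < length vs" "0 < length vs" "i < length vs" "Suc i < length vs"
          "length vs - 1 \<noteq> i" "length vs - 1 \<noteq> Suc i" "0 \<noteq> i" "0 \<noteq> Suc i"
          using i(1,2) Suc.prems(3,4) by linarith+
        ultimately show False by blast
      qed
      then have "e \<in> path_edge vs ` {0..<length vs - 1}" using e E_path by blast
      then obtain j where j: "Suc j < length vs" "e = path_edge vs j"
        by (auto simp: less_diff_conv)
      have "\<not> (Suc j < i \<or> Suc i < j)"
        using path_edge_disjoint_iff[OF vs j(1), of i] i j Suc.prems by auto
      moreover have "j \<notin> {a..<a + 4 * Suc k}" using False j by blast
      ultimately have j': "Suc j = a \<or> j = a + 4 * Suc k" using i by auto
      have cl: "clear ?L e = path_edge vs ` {i \<in> {a..<a + 4 * Suc k}. Suc i < j \<or> Suc j < i}"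
        unfolding j(2) using Suc.prems j(1) by (intro clear_path[OF vs]) auto
      \<comment> \<open>At either end, a path of \<open>4 * k + 3\<close> edges remains;
        \<open>t\<close> is its first index.\<close>
      obtain t where t: "0 < t" "Suc (t + 3 + 4 * k) < length vs"
        "clear ?L e = path_edge vs ` {t..<t + 3 + 4 * k}"
      proof (cases "Suc j = a")
        case True
        then have "{i \<in> {a..<a + 4 * Suc k}. Suc i < j \<or> Suc j < i} = {Suc a..<Suc a + 3 + 4 * k}"
          by auto
        then show ?thesis using that[of "Suc a"] cl Suc.prems by auto
      next
        case False
        then have "{i \<in> {a..<a + 4 * Suc k}. Suc i < j \<or> Suc j < i} = {a..<a + 3 + 4 * k}"
          using j' by auto
        then show ?thesis using that[of a] cl Suc.prems by auto
      qed
      \<comment> \<open>This answer dominates the first three edges left and restores a path of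
        \<open>4 * k\<close> edges.\<close>
      let ?d = "path_edge vs (Suc t)"
      have d: "?d \<in> E" using t E_path by auto
      have "?d \<in> clear ?L e" using t(3) by auto
      then have nd: "clear (clear ?L e) ?d \<noteq> clear ?L e"
        using clear_self edge_set_clear[OF L] by blast
      have "clear (clear ?L e) ?d = path_edge vs ` {i \<in> {t..<t + 3 + 4 * k}. Suc i < Suc t \<or> Suc (Suc t) < i}"
        unfolding t(3) using t by (intro clear_path[OF vs]) auto
      also have "{i \<in> {t..<t + 3 + 4 * k}. Suc i < Suc t \<or> Suc (Suc t) < i} = {t + 3..<t + 3 + 4 * k}"
        by auto
      finally have "live E (insert ?d (insert e D)) = path_edge vs ` {t + 3..<t + 3 + 4 * k}"
        by (simp only: live_insert[of E ?d] live')
      then have "remaining_moves E Staller (insert ?d (insert e D)) \<le> 2 * k"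
        using d D' t by (intro Suc.IH[of _ "t + 3"]) auto
      then have "remaining_moves E Dominator (insert e D) \<le> Suc (2 * k)"
        using nd by (intro remaining_moves_Dominator_le[OF E D' d]) (simp_all add: live')
      then show ?thesis by simp
    qed
  qed
  then show ?case by simp
qed

text \<open>Dominator opens with the closing edge. It dominates itself and its two neighbours, with
  indices \<open>0\<close> and \<open>4 * k + 1\<close>, and leaves a path of \<open>4 * k\<close>
  edges.\<close>

lemma Dominator_on_cycle:
  assumes E: "edge_set E" and vs: "distinct vs" and len: "length vs = 4 * k + 3"
    and E_eq: "E = set (closed_walk_edges vs)"
  shows "remaining_moves E Dominator {} \<le> 2 * k + 1"
proof -
  let ?e = "{vs ! (length vs - 1), vs ! 0}"
  have E_path: "E = insert ?e (path_edge vs ` {0..<length vs - 1})"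
    unfolding E_eq by (rule closed_walk_edges_eq_path) (use len in auto)
  have e: "?e \<in> E" using E_path by simp
  have meet: "?e \<inter> path_edge vs i = {} \<longleftrightarrow> 0 < i \<and> Suc i < length vs - 1" if "Suc i < length vs" for i
    using that vs len by (auto simp: path_edge_def nth_eq_iff_index_eq)
  have "{i \<in> {0..<length vs - 1}. ?e \<inter> path_edge vs i = {}} = {1..<1 + 4 * k}"
  proof (intro set_eqI)
    fix i
    show "i \<in> {i \<in> {0..<length vs - 1}. ?e \<inter> path_edge vs i = {}} \<longleftrightarrow> i \<in> {1..<1 + 4 * k}"
      using meet[of i] len unfolding mem_Collect_eq by (cases "Suc i < length vs") auto
  qed
  then have "clear (path_edge vs ` {0..<length vs - 1}) ?e = path_edge vs ` {1..<1 + 4 * k}"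
    by (simp only: clear_image)
  moreover have "clear E ?e = clear (path_edge vs ` {0..<length vs - 1}) ?e"
    by (subst E_path) (auto simp: clear_def)
  ultimately have "clear E ?e = path_edge vs ` {1..<1 + 4 * k}" by simp
  then have "live E (insert ?e {}) = path_edge vs ` {1..<1 + 4 * k}"
    by (simp only: live_insert live_empty)
  then have "remaining_moves E Staller (insert ?e {}) \<le> 2 * k"
    using e len by (intro Staller_on_path[OF E vs _ E_eq]) auto
  then have "remaining_moves E Dominator {} \<le> Suc (2 * k)"
    using clear_self[OF E e] e by (intro remaining_moves_Dominator_le[OF E]) simp_all
  then show ?thesis by simp
qed

section \<open>Edge dominating circuits\<close>

text \<open>The circuit as a periodic sequence, which lets it start at any of its positions.\<close>

definition walk :: "'a list \<Rightarrow> nat \<Rightarrow> 'a" where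
  "walk vs k = vs ! (k mod length vs)"

lemma walk_add_length [simp]: "walk vs (k + length vs) = walk vs k"
  by (simp add: walk_def)

lemma walk_edge_mod:
  "{walk vs (k mod length vs), walk vs (Suc (k mod length vs))} = {walk vs k, walk vs (Suc k)}"
  by (simp add: walk_def mod_Suc_eq)

lemma set_closed_walk_edges:
  "set (closed_walk_edges vs) = (\<lambda>k. {walk vs k, walk vs (Suc k)}) ` {..<length vs}"
  by (auto simp: closed_walk_edges_def walk_def)

lemma distinct_closed_walk_edges:
  "distinct (closed_walk_edges vs) \<longleftrightarrow>
    inj_on (\<lambda>k. {walk vs k, walk vs (Suc k)}) {..<length vs}"
proof -
  have "closed_walk_edges vs = map (\<lambda>k. {walk vs k, walk vs (Suc k)}) [0..<length vs]"
    by (auto simp: closed_walk_edges_def walk_def)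
  then show ?thesis by (simp add: distinct_map atLeast0LessThan)
qed

text \<open>A list of length 1 would give a singleton as an edge, and one of length 2 the same edge
  twice.\<close>

lemma circuit_length:
  assumes "edge_set E" "circuit E vs"
  shows "length vs \<ge> 3"
proof (rule ccontr)
  assume "\<not> length vs \<ge> 3"
  moreover have "vs \<noteq> []" using assms by (simp add: circuit_def)
  ultimately have "length vs = 1 \<or> length vs = 2"
    unfolding length_0_conv[symmetric] by linarith
  then show False
  proof
    assume "length vs = 1"
    then obtain a where "vs = [a]" by (auto simp: length_Suc_conv)
    then have "{a} \<in> E" using assms by (simp add: circuit_def closed_walk_edges_def)
    then show False using assms by (auto simp: edge_set_def)
  next
    assume "length vs = 2"
    then obtain a b where "vs = [a, b]" by (auto simp: length_Suc_conv numeral_2_eq_2)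
    then show False
      using assms by (simp add: circuit_def closed_walk_edges_def insert_commute)
  qed
qed

lemma walk_edge_circuit: "circuit E vs \<Longrightarrow> {walk vs k, walk vs (Suc k)} \<in> E"
proof -
  assume c: "circuit E vs"
  then have "k mod length vs < length vs" by (simp add: circuit_def)
  then have "{walk vs (k mod length vs), walk vs (Suc (k mod length vs))} \<in> E"
    using c unfolding circuit_def set_closed_walk_edges by blast
  then show ?thesis unfolding walk_edge_mod .
qed

text \<open>Every edge meets the circuit, so the first vertex of the circuit alone reaches all
  edges.\<close>

lemma weight_edge_dominating_circuit:
  assumes E: "edge_set E" and vs: "edge_dominating_circuit E vs"
  shows "weight E \<le> card E + 1"
proof -
  have c: "circuit E vs" using vs by (simp add: edge_dominating_circuit_def)
  have reach: "(walk vs 0, walk vs k) \<in> conn E" for k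
    using walk_edge_circuit[OF c] by (intro walk_conn) auto
  have "spans E {walk vs 0}" unfolding spans_def
  proof
    fix x assume "x \<in> \<Union>E"
    then obtain e where e: "e \<in> E" "x \<in> e" by blast
    obtain y where y: "e = {x, y}" using edge_set_edge[OF E e] .
    obtain k where k: "k < length vs" "vs ! k \<in> e"
      using vs e(1) unfolding edge_dominating_circuit_def
      by (metis disjoint_iff in_set_conv_nth)
    then have "x = walk vs k \<or> y = walk vs k" using y by (auto simp: walk_def)
    moreover have "{y, x} \<in> E" using e y by (simp add: insert_commute)
    ultimately have "(walk vs 0, x) \<in> conn E" using reach[of k] conn_step by metis
    then show "\<exists>r\<in>{walk vs 0}. (r, x) \<in> conn E" by simp
  qed
  then have "ncomp E \<le> 1" using ncomp_le[of "{walk vs 0}"] by simp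
  then show ?thesis by (simp add: weight_def)
qed

text \<open>If an edge other than the two circuit edges at some position contains the vertex there,
  the circuit is rotated to start at it and \<open>first_move_gain\<close> applies. Otherwise no
  vertex repeats and, as every edge meets the circuit, there are no further edges.\<close>

lemma circuit_gain_or_cycle:
  assumes E: "edge_set E" and vs: "edge_dominating_circuit E vs"
  shows "(\<exists>e\<in>E. weight (clear E e) + 4 \<le> weight E) \<or>
    distinct vs \<and> E = set (closed_walk_edges vs)"
proof -
  define n where "n = length vs"
  define c where "c k = {walk vs k, walk vs (Suc k)}" for k
  have circ: "circuit E vs" using vs by (simp add: edge_dominating_circuit_def)
  have n: "n \<ge> 3" unfolding n_def using E circ by (rule circuit_length)
  have cE: "c k \<in> E" for k unfolding c_def using circ by (rule walk_edge_circuit)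
  have c_mod: "c (k mod n) = c k" for k unfolding c_def n_def by (rule walk_edge_mod)
  have "inj_on c {..<n}"
    using circ distinct_closed_walk_edges[of vs] unfolding circuit_def c_def n_def by blast
  then have c_eq: "i mod n = j mod n" if "c i = c j" for i j
    using that c_mod[of i] c_mod[of j] n unfolding inj_on_def by auto
  have dom: "\<exists>k<n. walk vs k \<in> e" if "e \<in> E" for e
  proof -
    obtain k where "k < n" "vs ! k \<in> e"
      using vs \<open>e \<in> E\<close> unfolding edge_dominating_circuit_def n_def
      by (metis disjoint_iff in_set_conv_nth)
    then show ?thesis by (auto simp: walk_def n_def)
  qed
  show ?thesis
  \<comment> \<open>The edge \<open>c (i + (n - 1))\<close> is the one that enters position
    \<open>i\<close>; adding \<open>n - 1\<close> instead of subtracting 1 covers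
    \<open>i = 0\<close>.\<close>
  proof (cases "\<exists>i<n. \<exists>h\<in>E. walk vs i \<in> h \<and> h \<noteq> c i \<and> h \<noteq> c (i + (n - 1))")
    case True
    then obtain i h where i: "i < n"
      and h: "h \<in> E" "walk vs i \<in> h" "h \<noteq> c i" "h \<noteq> c (i + (n - 1))" by blast
    have per: "walk vs (i + n) = walk vs i" by (simp add: n_def)
    have "\<exists>e\<in>E. weight (clear E e) + 4 \<le> weight E"
    proof (rule first_move_gain[OF E n, where p = "\<lambda>k. walk vs (i + k)" and h = h])
      show "{walk vs (i + k), walk vs (i + Suc k)} \<in> E" for k
        using cE[of "i + k"] by (simp add: c_def)
      show "inj_on (\<lambda>k. {walk vs (i + k), walk vs (i + Suc k)}) {..<n}"
      proof (rule inj_onI)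
        fix k l assume kl: "k \<in> {..<n}" "l \<in> {..<n}"
          "{walk vs (i + k), walk vs (i + Suc k)} = {walk vs (i + l), walk vs (i + Suc l)}"
        then have "c (i + k) = c (i + l)" by (simp add: c_def)
        then have "[i + k = i + l] (mod n)" unfolding cong_def by (rule c_eq)
        then have "[k = l] (mod n)" by (simp add: cong_add_lcancel_nat)
        then show "k = l" using kl by (simp add: cong_def)
      qed
      show "walk vs (i + n) = walk vs (i + 0)" using per by simp
      show "\<exists>k<n. walk vs (i + k) \<in> e" if e: "e \<in> E" for e
      proof -
        obtain j where j: "j < n" "walk vs j \<in> e" using dom[OF e] by blast
        \<comment> \<open>Position \<open>j\<close> has index \<open>(j + n - i) mod n\<close> in
          the circuit rotated to start at \<open>i\<close>.\<close>
        have "(i + (j + n - i) mod n) mod n = j"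
          using i j by (simp add: mod_add_right_eq)
        then have "walk vs (i + (j + n - i) mod n) = walk vs j"
          using j by (simp add: walk_def n_def)
        then show ?thesis using j n by (intro exI[of _ "(j + n - i) mod n"]) auto
      qed
      show "h \<noteq> {walk vs (i + 0), walk vs (i + 1)}" using h by (simp add: c_def)
      have "Suc (i + (n - 1)) = i + n" using n by simp
      then show "h \<noteq> {walk vs (i + (n - 1)), walk vs (i + 0)}"
        using h(4) per unfolding c_def by simp
    qed (use h in simp_all)
    then show ?thesis ..
  next
    case False
    then have two: "h = c i \<or> h = c (i + (n - 1))" if "i < n" "h \<in> E" "walk vs i \<in> h" for i h
      using that by blast
    \<comment> \<open>A repeated vertex would make \<open>c j\<close> one of the two circuit edges
      at position \<open>i\<close>. Injectivity forces \<open>i = 0\<close> and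
      \<open>j = n - 1\<close>, and then \<open>c j\<close> is a loop.\<close>
    have "vs ! i \<noteq> vs ! j" if ij: "i < j" "j < n" for i j
    proof
      assume "vs ! i = vs ! j"
      then have eq: "walk vs i = walk vs j" using ij by (simp add: walk_def n_def)
      then have "c j = c i \<or> c j = c (i + (n - 1))"
        using two[of i "c j"] cE ij by (simp add: c_def)
      then have "j mod n = i mod n \<or> j mod n = (i + (n - 1)) mod n" using c_eq by blast
      then have j: "j = (i + (n - 1)) mod n" using ij by simp
      have "i = 0"
      proof (rule ccontr)
        assume "i \<noteq> 0"
        then have "i + (n - 1) = (i - 1) + n" using n by simp
        then have "(i + (n - 1)) mod n = (i - 1 + n) mod n" by (simp only:)
        also have "\<dots> = i - 1" using ij by (subst mod_add_self2) simp
        finally have "(i + (n - 1)) mod n = i - 1" .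
        then show False using j ij by simp
      qed
      then have "Suc j = 0 + n" using j n by simp
      then have "walk vs (Suc j) = walk vs i" using \<open>i = 0\<close> by (simp add: walk_def n_def)
      then have "c j = {walk vs j}" using eq by (simp add: c_def)
      then show False using cE[of j] E by (auto simp: edge_set_def)
    qed
    then have "distinct vs"
      unfolding distinct_conv_nth n_def by (metis linorder_neqE_nat)
    moreover have "E \<subseteq> set (closed_walk_edges vs)"
    proof
      fix e assume e: "e \<in> E"
      then obtain i where i: "i < n" "walk vs i \<in> e" using dom by blast
      then obtain k where "e = c k" using two[OF i(1) e] by blast
      then have "e = c (k mod n)" "k mod n < n" using c_mod n by auto
      then show "e \<in> set (closed_walk_edges vs)"
        unfolding set_closed_walk_edges c_def n_def by blast
    qed
    ultimately show ?thesis using circ by (auto simp: circuit_def)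
  qed
qed

lemma non_isolated_cycle:
  assumes "fin_simple_graph V E" "E = set (closed_walk_edges vs)" "vs \<noteq> []"
  shows "non_isolated V E = set vs"
proof -
  interpret fin_simple_graph V E by fact
  have E: "E = (\<lambda>k. {walk vs k, walk vs (Suc k)}) ` {..<length vs}"
    unfolding assms(2) by (rule set_closed_walk_edges)
  have "walk vs k \<in> set vs" for k using assms(3) by (simp add: walk_def)
  then have "non_isolated V E \<subseteq> set vs" by (auto simp: non_isolated_def E)
  moreover have "set vs \<subseteq> non_isolated V E"
  proof
    fix v assume "v \<in> set vs"
    then obtain k where "k < length vs" "v = walk vs k"
      by (auto simp: in_set_conv_nth walk_def)
    then have "{walk vs k, walk vs (Suc k)} \<in> E" "v \<in> {walk vs k, walk vs (Suc k)}"
      by (auto simp: E)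
    then show "v \<in> non_isolated V E" unfolding non_isolated_def using edge_subset by blast
  qed
  ultimately show ?thesis by blast
qed

theorem theorem4p4:
  fixes V :: "'a set" and E :: "'a set set"
  assumes "fin_simple_graph V E"
    and "\<exists>vs. edge_dominating_circuit E vs"
  shows "int (game_edge_domination_number E) \<le> \<lceil>real (card E) / 2\<rceil>
    \<and> (\<not> (\<exists>n. cycle_graph (non_isolated V E) E n \<and> [n = 1] (mod 4)) \<longrightarrow>
         int (game_edge_domination_number E) \<le> \<lfloor>real (card E) / 2\<rfloor>)"
proof -
  interpret fin_simple_graph V E by fact
  have "E \<subseteq> Pow V" using edge_subset by blast
  then have E: "edge_set E"
    using finite_V card_edge by (auto simp: edge_set_def intro: finite_subset)
  obtain vs where vs: "edge_dominating_circuit E vs" using assms by blast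
  have weight: "weight E \<le> card E + 1" using E vs by (rule weight_edge_dominating_circuit)
  let ?g = "game_edge_domination_number E"
  have "?g \<le> weight E div 2"
    using remaining_moves_le_weight[OF E, of "{}"] by (simp add: game_edge_domination_number_def)
  also have "\<dots> \<le> (card E + 1) div 2" using weight by (rule div_le_mono)
  finally have general: "?g \<le> (card E + 1) div 2" .
  have "?g \<le> card E div 2"
    if not_exc: "\<not> (\<exists>n. cycle_graph (non_isolated V E) E n \<and> [n = 1] (mod 4))"
  \<comment> \<open>For even \<open>card E\<close> the general bound already equals
    \<open>card E div 2\<close>.\<close>
  proof (cases "even (card E)")
    case True
    then show ?thesis using general by simp
  next
    case odd: False
    from circuit_gain_or_cycle[OF E vs] show ?thesis
    proof (elim disjE bexE conjE)
      fix e assume e: "e \<in> E" and gain: "weight (clear E e) + 4 \<le> weight E"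
      have "live E {e} = clear E e" by (simp only: live_insert live_empty)
      then have "remaining_moves E Staller {e} \<le> (weight (clear E e) + 1) div 2"
        using remaining_moves_le_weight[OF E, of "{e}"] e by simp
      then have "?g \<le> Suc ((weight (clear E e) + 1) div 2)"
        unfolding game_edge_domination_number_def using e clear_self[OF E e]
        by (intro remaining_moves_Dominator_le[OF E]) auto
      \<comment> \<open>After this move the weight is at most \<open>card E - 3\<close>, which
        allows at most \<open>(card E - 2) div 2\<close> further moves.\<close>
      with gain weight odd show ?thesis by presburger
    next
      assume dist: "distinct vs" and E_eq: "E = set (closed_walk_edges vs)"
      have circ: "circuit E vs" using vs by (simp add: edge_dominating_circuit_def)
      have len: "length vs \<ge> 3" using E circ by (rule circuit_length)
      have "card E = length (closed_walk_edges vs)"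
        using circ E_eq distinct_card[of "closed_walk_edges vs"] by (simp add: circuit_def)
      then have m: "card E = length vs" by (simp add: closed_walk_edges_def)
      have "non_isolated V E = set vs"
        using len by (intro non_isolated_cycle[OF assms(1) E_eq]) auto
      then have "cycle_graph (non_isolated V E) E (length vs)"
        unfolding cycle_graph_def using dist E_eq len by blast
      then have "length vs mod 4 \<noteq> 1" using not_exc by (auto simp: cong_def)
      with odd m have "length vs mod 4 = 3" by presburger
      then have "length vs = 4 * (length vs div 4) + 3" by presburger
      from Dominator_on_cycle[OF E dist this E_eq] this m show ?thesis
        unfolding game_edge_domination_number_def by linarith
    qed
  qed
  moreover have "\<lceil>real (card E) / 2\<rceil> = int ((card E + 1) div 2)"
    by (cases "even (card E)") (auto elim!: evenE oddE simp: ceiling_unique ceiling_eq_iff)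
  moreover have "\<lfloor>real (card E) / 2\<rfloor> = int (card E div 2)"
    using floor_divide_of_nat_eq[of "card E" 2] by simp
  ultimately show ?thesis using general by simp
qed

end
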